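(* Let $B$ be a unital $C^*$-algebra and let $M\subset B$ be a unital subspace. Let $\omega$ be a state on $B$. Consider the following statements. (i) $\omega|_M$ admits a unique extension to a state on $B$. (ii) $\Phi_\omega|_{\mathcal{A}(M)}$ admits a unique extension to a state on $\mathbb{M}_2(B)$. (iii) $\omega$ is an $M$-peak state. (iv) $\Phi_\omega$ is an $\mathcal{A}(M)$-peak state. Then (i) $\Leftrightarrow$ (ii) and (iv) $\Rightarrow$ (iii). If $B$ is commutative, then (iii) $\Leftrightarrow$ (iv).
   Context: A unital subspace of a unital $C^*$-algebra is a complex linear subspace containing the unit. States are unital contractive linear functionals; $\mathcal{S}(C)$ denotes the state space of a unital $C^*$-algebra $C$. For a subset $X\subset C$, a state $\omega$ on $C$ is an $X$-peak state if there is $x\in X$ such that $\omega(x)=1$ and $|\psi(x)|<1$ for every $\psi\in\mathcal{S}(C)$ with $\psi\ne\omega$. $\mathcal{A}(M)\subset\mathbb{M}_2(B)$ is the unital subalgebra of all elements $\begin{bmatrix}\lambda I& x\\0&\lambda I\end{bmatrix}$ with $\lambda\in\mathbb{C}$ and $x\in M$. For a state $\omega$ on $B$, $\Phi_\omega$ is the state on $\mathbb{M}_2(B)$ given by $$\Phi_\omega([b_{ij}])=\tfrac12\big(\omega(b_{11})+\omega(b_{12})+\omega(b_{21})+\omega(b_{22})\big),$$ i.e. $\Phi_\omega([b_{ij}])=\langle[\omega(b_{ij})]v,v\rangle_{\mathbb{C}^2}$ with $v=\frac{1}{\sqrt2}(1,1)$. *)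

theory Defs
  imports "HOL-Analysis.Analysis"
begin

class complex_star_algebra = ring_1 +
  fixes scaleC :: "complex \<Rightarrow> 'a \<Rightarrow> 'a"  (infixr "*C" 75)
    and adj :: "'a \<Rightarrow> 'a"
  assumes scaleC_add_right: "c *C (x + y) = c *C x + c *C y"
    and scaleC_add_left: "(c + d) *C x = c *C x + d *C x"
    and scaleC_scaleC: "c *C (d *C x) = (c * d) *C x"
    and scaleC_one: "1 *C x = x"
    and scaleC_mult_left: "(c *C x) * y = c *C (x * y)"
    and scaleC_mult_right: "x * (c *C y) = c *C (x * y)"
    and adj_adj: "adj (adj x) = x"
    and adj_add: "adj (x + y) = adj x + adj y"
    and adj_scaleC: "adj (c *C x) = cnj c *C adj x"
    and adj_mult: "adj (x * y) = adj y * adj x"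

lemma scaleC_zero: "c *C (0 :: 'a::complex_star_algebra) = 0"
  using scaleC_add_right[of c 0 "0 :: 'a"] by simp

lemma adj_zero: "adj (0 :: 'a::complex_star_algebra) = 0"
  using adj_add[of 0 "0 :: 'a"] by simp

text \<open>Unital \<open>C\<^sup>*\<close>-algebras. The superclasses force \<open>0 \<noteq> 1\<close>, which only excludes the zero
  algebra; that algebra has no states.\<close>

class cstar_algebra = complex_star_algebra + real_normed_algebra_1 + banach +
  assumes scaleR_eq_scaleC: "r *\<^sub>R x = complex_of_real r *C x"
    and norm_scaleC: "norm (c *C x) = cmod c * norm x"
    and cstar_identity: "norm (adj x * x) = (norm x)\<^sup>2"

text \<open>The same notion for a norm that is not part of the type: \<open>N\<close> turns the \<open>*\<close>-algebra
  \<open>'a\<close> into a \<open>C\<^sup>*\<close>-algebra. The last conjunct is completeness. A \<open>*\<close>-algebra carries at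
  most one such norm.\<close>

definition cstar_norm :: "('a::complex_star_algebra \<Rightarrow> real) \<Rightarrow> bool" where
  "cstar_norm N \<longleftrightarrow>
     (\<forall>x. 0 \<le> N x) \<and>
     (\<forall>x. N x = 0 \<longleftrightarrow> x = 0) \<and>
     (\<forall>x y. N (x + y) \<le> N x + N y) \<and>
     (\<forall>c x. N (c *C x) = cmod c * N x) \<and>
     (\<forall>x y. N (x * y) \<le> N x * N y) \<and>
     (\<forall>x. N (adj x * x) = (N x)\<^sup>2) \<and>
     (\<forall>X :: nat \<Rightarrow> 'a.
        (\<forall>e>0. \<exists>n0. \<forall>m\<ge>n0. \<forall>n\<ge>n0. N (X m - X n) < e) \<longrightarrow>
        (\<exists>L. (\<lambda>n. N (X n - L)) \<longlonglongrightarrow> 0))"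

lemma cstar_norm_norm: "cstar_norm (norm :: 'a::cstar_algebra \<Rightarrow> real)"
proof -
  have "\<exists>L. (\<lambda>n. norm (X n - L)) \<longlonglongrightarrow> 0"
    if "\<forall>e>0. \<exists>n0. \<forall>m\<ge>n0. \<forall>n\<ge>n0. norm (X m - X n) < e" for X :: "nat \<Rightarrow> 'a"
  proof -
    from that have "Cauchy X"
      unfolding Cauchy_def dist_norm by blast
    then obtain L where "X \<longlonglongrightarrow> L"
      using Cauchy_convergent convergent_def by blast
    then show ?thesis
      using LIM_zero tendsto_norm_zero by blast
  qed
  then show ?thesis
    unfolding cstar_norm_def
    by (auto simp: norm_triangle_ineq norm_mult_ineq norm_scaleC cstar_identity)
qed

definition states :: "('a::complex_star_algebra \<Rightarrow> real) \<Rightarrow> ('a \<Rightarrow> complex) set" where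
  "states N = {f. (\<forall>x y. f (x + y) = f x + f y) \<and> (\<forall>c x. f (c *C x) = c * f x) \<and>
                  f 1 = 1 \<and> (\<forall>x. cmod (f x) \<le> N x)}"

definition unital_subspace :: "'a::complex_star_algebra set \<Rightarrow> bool" where
  "unital_subspace M \<longleftrightarrow>
     1 \<in> M \<and> (\<forall>x\<in>M. \<forall>y\<in>M. x + y \<in> M) \<and> (\<forall>c. \<forall>x\<in>M. c *C x \<in> M)"

definition has_unique_state_extension ::
    "('a::complex_star_algebra \<Rightarrow> real) \<Rightarrow> 'a set \<Rightarrow> ('a \<Rightarrow> complex) \<Rightarrow> bool" where
  "has_unique_state_extension N X f \<longleftrightarrow> (\<exists>!g. g \<in> states N \<and> (\<forall>x\<in>X. g x = f x))"

definition peak_state ::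
    "('a::complex_star_algebra \<Rightarrow> real) \<Rightarrow> 'a set \<Rightarrow> ('a \<Rightarrow> complex) \<Rightarrow> bool" where
  "peak_state N X f \<longleftrightarrow> f \<in> states N \<and>
     (\<exists>x\<in>X. f x = 1 \<and> (\<forall>g\<in>states N. g \<noteq> f \<longrightarrow> cmod (g x) < 1))"

text \<open>The \<open>*\<close>-algebra of 2-by-2 matrices. A type of its own is needed because multiplication on
  \<open>'a ^ 2 ^ 2\<close> is already the componentwise one.\<close>

datatype 'a mat2 = Mat2 (m11: 'a) (m12: 'a) (m21: 'a) (m22: 'a)

instantiation mat2 :: (complex_star_algebra) complex_star_algebra
begin

definition "0 = Mat2 0 0 0 0"
definition "1 = Mat2 1 0 0 1"
definition "a + b = Mat2 (m11 a + m11 b) (m12 a + m12 b) (m21 a + m21 b) (m22 a + m22 b)"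
definition "a - b = Mat2 (m11 a - m11 b) (m12 a - m12 b) (m21 a - m21 b) (m22 a - m22 b)"
definition "- a = Mat2 (- m11 a) (- m12 a) (- m21 a) (- m22 a)"
definition "a * b =
  Mat2 (m11 a * m11 b + m12 a * m21 b) (m11 a * m12 b + m12 a * m22 b)
       (m21 a * m11 b + m22 a * m21 b) (m21 a * m12 b + m22 a * m22 b)"
definition "c *C a = Mat2 (c *C m11 a) (c *C m12 a) (c *C m21 a) (c *C m22 a)"
definition "adj a = Mat2 (adj (m11 a)) (adj (m21 a)) (adj (m12 a)) (adj (m22 a))"

lemmas mat2_defs = zero_mat2_def one_mat2_def plus_mat2_def minus_mat2_def uminus_mat2_def
  times_mat2_def scaleC_mat2_def adj_mat2_def

instance
  by standard
    (auto simp: mat2_defs algebra_simps scaleC_add_right scaleC_add_left scaleC_scaleC scaleC_one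
      scaleC_mult_left scaleC_mult_right adj_adj adj_add adj_scaleC adj_mult)

end

definition triangular_algebra :: "'a::complex_star_algebra set \<Rightarrow> 'a mat2 set" where
  "triangular_algebra M = {Mat2 (c *C 1) x 0 (c *C 1) | c x. x \<in> M}"

definition Phi :: "('a \<Rightarrow> complex) \<Rightarrow> 'a mat2 \<Rightarrow> complex" where
  "Phi f a = (f (m11 a) + f (m12 a) + f (m21 a) + f (m22 a)) / 2"

end

theory Submission
  imports Defs
begin

text \<open>Write \<open>p\<close> for the matrix with all four entries \<open>1/2\<close>, the projection onto the vector \<open>v = (1, 1) / \<surd>2\<close>.
  The state \<open>Phi \<omega>\<close> is \<open>\<omega>\<close> composed with the compression \<open>a \<mapsto> p a p\<close>, whose range consists of the matrices
  \<open>b \<otimes> p\<close>.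
  
  Unique extension. Every triangular algebra contains \<open>E\<^sub>1\<^sub>2\<close>, and \<open>Phi \<omega>\<close> takes the value \<open>1/2\<close> there. A state
  \<open>\<Psi>\<close> of the matrix algebra with \<open>\<Psi> E\<^sub>1\<^sub>2 = 1/2\<close> satisfies \<open>\<Psi> p = 1\<close>, hence \<open>\<Psi> a = \<Psi> (p a p)\<close>, and so it is
  \<open>Phi \<psi>\<close> for the state \<open>\<psi> b = \<Psi> (diag (b, b))\<close> (\<open>state_eq_Phi\<close>). Thus \<open>Phi\<close> is a bijection from the state
  extensions of the restriction of \<open>\<omega>\<close> to \<open>M\<close> onto those of the restriction of \<open>Phi \<omega>\<close> to the triangular
  algebra (\<open>extensions_of_Phi\<close>). That \<open>Phi\<close> and its inverse preserve states rests on the fact that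
  \<open>*\<close>-homomorphisms of \<open>C\<^sup>*\<close>-algebras are contractive (\<open>star_hom_contractive\<close>).
  
  Peak states. If the triangular matrix with diagonal \<open>\<lambda>\<close> and corner \<open>x\<close> peaks at \<open>Phi \<omega>\<close>, then \<open>\<lambda> + x / 2\<close>
  peaks at \<open>\<omega>\<close>, because \<open>Phi \<psi>\<close> takes on the former the value that \<open>\<psi>\<close> takes on the latter. For the
  converse over a commutative algebra, let \<open>x\<close> peak at \<open>\<omega>\<close> and take the matrix with diagonal \<open>1/2\<close> and
  corner \<open>x\<close>. Let \<open>\<Psi>\<close> be a state and \<open>\<rho> b = \<Psi> (diag (b, b))\<close>. The hermitian matrix with
  corners \<open>x\<close> and \<open>x\<^sup>*\<close> has square \<open>diag (x\<^sup>* x, x\<^sup>* x)\<close>, so the Schwarz inequality bounds the value of \<open>\<Psi>\<close> at the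
  corner \<open>x\<close> by half the root of \<open>\<rho> (x\<^sup>* x)\<close> (\<open>corner_bound\<close>). It remains to see that \<open>\<rho> (x\<^sup>* x) \<le> 1\<close>, with
  equality only for \<open>\<rho> = \<omega>\<close> (\<open>peak_commutative\<close>). In terms of characters, \<open>|x|\<close> is at most \<open>1\<close> on the spectrum
  and equals \<open>1\<close> at most at the point \<open>\<omega>\<close>. Instead of characters, the proof uses a state that
  maximises \<open>x\<^sup>* x\<close>, then \<open>- Re x\<close>, then \<open>- Im x\<close>: such states form a face of the state space on which
  \<open>x\<close> is constant, and this forces multiplicativity at \<open>x\<close> (\<open>dominating_state\<close>).\<close>

section \<open>Elementary algebra\<close>

lemma scaleC_zero_left: "0 *C (x::'a::complex_star_algebra) = 0"
  using scaleC_add_left[of 0 0 x] by simp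

lemma scaleC_minus_left: "(- c) *C (x::'a::complex_star_algebra) = - (c *C x)"
  using scaleC_add_left[of "- c" c x] by (simp add: scaleC_zero_left eq_neg_iff_add_eq_0)

lemma scaleC_minus_right: "c *C (- x::'a::complex_star_algebra) = - (c *C x)"
  using scaleC_add_right[of c "- x" x] by (simp add: scaleC_zero eq_neg_iff_add_eq_0)

lemma scaleC_diff_right: "c *C (x - y::'a::complex_star_algebra) = c *C x - c *C y"
  using scaleC_add_right[of c x "- y"] by (simp add: scaleC_minus_right)

lemma scaleC_half_double: "(1/2) *C (x + x :: 'a::complex_star_algebra) = x"
  using scaleC_add_left[of "1/2" "1/2" x] by (simp add: scaleC_add_right scaleC_one)

lemma adj_one: "adj (1::'a::complex_star_algebra) = 1"
  by (metis adj_adj adj_mult mult.right_neutral)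

lemma adj_minus: "adj (- x::'a::complex_star_algebra) = - adj x"
  using adj_add[of "- x" x] by (simp add: adj_zero eq_neg_iff_add_eq_0)

lemma adj_diff: "adj (x - y::'a::complex_star_algebra) = adj x - adj y"
  using adj_add[of x "- y"] by (simp add: adj_minus)

lemmas star_simps = scaleC_zero scaleC_zero_left scaleC_minus_left scaleC_minus_right
  scaleC_diff_right scaleC_add_right scaleC_scaleC scaleC_one scaleC_mult_left
  scaleC_mult_right adj_zero adj_one adj_minus adj_diff adj_adj adj_add adj_scaleC adj_mult

lemma hermitian_decomposition:
  fixes a :: "'a::complex_star_algebra"
  obtains h k where "adj h = h" "adj k = k" "a = h + \<i> *C k" "adj a = h - \<i> *C k"
proof -
  let ?h = "(1/2) *C (a + adj a)" and ?k = "(\<i>/2) *C (adj a - a)"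
  have half: "(1/2) *C z + (1/2) *C z = z" for z :: 'a
    using scaleC_half_double[of z] by (simp add: scaleC_add_right)
  show ?thesis
  proof (rule that)
    show "adj ?h = ?h" by (simp add: star_simps add.commute)
    show "adj ?k = ?k" by (simp add: star_simps)
    show "a = ?h + \<i> *C ?k"
      using half[of a] by (simp add: star_simps)
    show "adj a = ?h - \<i> *C ?k"
      using half[of "adj a"] by (simp add: star_simps)
  qed
qed

lemma state_simps:
  assumes "f \<in> states N"
  shows "f (x + y) = f x + f y" "f (c *C x) = c * f x" "f 1 = 1" "cmod (f x) \<le> N x"
    "f 0 = 0" "f (- x) = - f x" "f (x - y) = f x - f y"
proof -
  show 1: "f (x + y) = f x + f y" "f (c *C x) = c * f x" "f 1 = 1" "cmod (f x) \<le> N x" for x y c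
    using assms unfolding states_def by auto
  show 0: "f 0 = 0" using 1(2)[of 0 0] by (simp add: star_simps)
  show m: "f (- x) = - f x" for x
    using 1(1)[of "- x" x] 0 by (simp add: eq_neg_iff_add_eq_0)
  show "f (x - y) = f x - f y" using 1(1)[of x "- y"] m by simp
qed

section \<open>Square roots and unitaries\<close>

locale cstar_normed =
  fixes N :: "'a::complex_star_algebra \<Rightarrow> real"
  assumes cstar: "cstar_norm N"
begin

lemmas N_nonneg = cstar[unfolded cstar_norm_def, THEN conjunct1, rule_format]
  and N_eq_0 = cstar[unfolded cstar_norm_def, THEN conjunct2, THEN conjunct1, rule_format]
  and N_triangle = cstar[unfolded cstar_norm_def, THEN conjunct2, THEN conjunct2, THEN conjunct1, rule_format]
  and N_scaleC = cstar[unfolded cstar_norm_def, THEN conjunct2, THEN conjunct2, THEN conjunct2, THEN conjunct1, rule_format]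
  and N_mult = cstar[unfolded cstar_norm_def, THEN conjunct2, THEN conjunct2, THEN conjunct2, THEN conjunct2, THEN conjunct1, rule_format]
  and N_star = cstar[unfolded cstar_norm_def, THEN conjunct2, THEN conjunct2, THEN conjunct2, THEN conjunct2, THEN conjunct2, THEN conjunct1, rule_format]

lemma N_complete:
  assumes "\<And>e. e > 0 \<Longrightarrow> \<exists>n0. \<forall>m\<ge>n0. \<forall>n\<ge>n0. N (X m - X n) < e"
  obtains L where "(\<lambda>n. N (X n - L)) \<longlonglongrightarrow> 0"
  using cstar[unfolded cstar_norm_def, THEN conjunct2, THEN conjunct2, THEN conjunct2,
      THEN conjunct2, THEN conjunct2, THEN conjunct2, rule_format, of X] assms by blast

lemma N_minus: "N (- x) = N x"
  using N_scaleC[of "-1" x] by (simp add: star_simps)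

lemma N_diff: "N (x - y) \<le> N x + N y"
  using N_triangle[of x "- y"] by (simp add: N_minus)

lemma N_one: "N 1 = 1"
  using N_star[of 1] N_eq_0[of 1] by (simp add: star_simps power2_eq_square)

lemma N_adj: "N (adj x) = N x"
proof -
  have "N y \<le> N (adj y)" for y
  proof (cases "N y = 0")
    case False
    have "N y * N y \<le> N (adj y) * N y"
      using N_star[of y] N_mult[of "adj y" y] by (simp add: power2_eq_square)
    then show ?thesis using False N_nonneg[of y] by simp
  qed (simp add: N_nonneg)
  from this[of x] this[of "adj x"] show ?thesis by (simp add: adj_adj)
qed

lemma zero_if_N_le_tendsto_0:
  assumes "\<And>n. N a \<le> d n" "d \<longlonglongrightarrow> 0"
  shows "a = 0"
proof -
  have "N a \<le> 0" using assms LIMSEQ_le_const by blast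
  then show ?thesis using N_eq_0 N_nonneg[of a] by simp
qed

text \<open>Writing the root as \<open>1 - L\<close> turns \<open>c\<^sup>2 = 1 - x\<close> into the fixed-point equation \<open>L = (x + L\<^sup>2) / 2\<close>. The
  right-hand side maps the ball of radius \<open>t = 1 - \<surd>(1 - N x) < 1\<close> to itself and is there a contraction
  with factor \<open>t\<close>. Its iterates from \<open>0\<close> are hermitian and commute with everything that commutes
  with \<open>x\<close>, and both properties pass to the limit.\<close>

lemma sqrt_one_minus:
  assumes x: "adj x = x" "N x < 1"
  obtains c where "adj c = c" "c * c = 1 - x" "\<And>z. z * x = x * z \<Longrightarrow> z * c = c * z"
proof -
  define y where "y = rec_nat 0 (\<lambda>_ v. (1/2) *C (x + v * v))"
  have y0: "y 0 = 0" and yS: "y (Suc n) = (1/2) *C (x + y n * y n)" for n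
    by (simp_all add: y_def)
  define t where "t = 1 - sqrt (1 - N x)"
  have t: "0 \<le> t" "t < 1" using x N_nonneg[of x] by (auto simp: t_def)
  have t_fix: "(N x + t * t) / 2 = t"
  proof -
    have "(a + (1 - q) * (1 - q)) / 2 = 1 - q" if "q * q = 1 - a" for a q :: real
      using that by (simp add: field_simps)
    moreover have "sqrt (1 - N x) * sqrt (1 - N x) = 1 - N x" using x by simp
    ultimately show ?thesis unfolding t_def by blast
  qed
  have y_le: "N (y n) \<le> t" for n
  proof (induction n)
    case 0 then show ?case using t N_eq_0[of 0] by (simp add: y0)
  next
    case (Suc n)
    have "N (x + y n * y n) \<le> N x + N (y n) * N (y n)"
      using N_triangle[of x "y n * y n"] N_mult[of "y n" "y n"] by linarith
    also have "\<dots> \<le> N x + t * t" using Suc t N_nonneg by (simp add: mult_mono)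
    finally show ?case using t_fix by (simp add: yS N_scaleC)
  qed
  have sq_diff: "N (a * a - b * b) \<le> N (a - b) * (N a + N b)" for a b
  proof -
    have "a * a - b * b = (a - b) * a + b * (a - b)" by (simp add: algebra_simps)
    then show ?thesis
      using N_triangle[of "(a - b) * a" "b * (a - b)"] N_mult[of "a - b" a] N_mult[of b "a - b"]
      by (simp add: algebra_simps)
  qed
  have step: "N ((1/2) *C (x + a * a) - (1/2) *C (x + b * b)) \<le> N (a - b) * (N a + N b) / 2" for a b
  proof -
    have "(1/2) *C (x + a * a) - (1/2) *C (x + b * b) = (1/2) *C (a * a - b * b)"
      by (simp add: star_simps)
    then show ?thesis using sq_diff[of a b] by (simp add: N_scaleC)
  qed
  have geo: "N (y (n + k) - y n) \<le> t ^ n" for n k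
  proof (induction n)
    case 0 then show ?case using y_le[of k] t by (simp add: y0)
  next
    case (Suc n)
    have "N (y (Suc n + k) - y (Suc n)) \<le> N (y (n + k) - y n) * (N (y (n + k)) + N (y n)) / 2"
      using step[of "y (n + k)" "y n"] by (simp add: yS)
    also have "\<dots> \<le> N (y (n + k) - y n) * (2 * t) / 2"
      using y_le[of "n + k"] y_le[of n] N_nonneg by (intro divide_right_mono mult_left_mono) auto
    also have "\<dots> \<le> t ^ Suc n" using Suc t by (simp add: mult.commute mult_left_mono)
    finally show ?case .
  qed
  have "\<exists>n0. \<forall>m\<ge>n0. \<forall>n\<ge>n0. N (y m - y n) < e" if "e > 0" for e
  proof -
    obtain n0 where n0: "t ^ n0 < e / 2"
      using real_arch_pow_inv[of "e / 2" t] \<open>e > 0\<close> t by auto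
    have "N (y m - y n) < e" if "m \<ge> n0" "n \<ge> n0" for m n
    proof -
      have "N (y m - y n0) \<le> t ^ n0" "N (y n - y n0) \<le> t ^ n0"
        using geo[of n0 "m - n0"] geo[of n0 "n - n0"] that by simp_all
      then show ?thesis using N_diff[of "y m - y n0" "y n - y n0"] n0 by simp
    qed
    then show ?thesis by blast
  qed
  then obtain L where L: "(\<lambda>n. N (y n - L)) \<longlonglongrightarrow> 0" using N_complete by blast
  have lim: "(\<lambda>n. N (y n - L) * C) \<longlonglongrightarrow> 0" for C using tendsto_mult_left_zero[OF L] .
  have fixpoint: "(1/2) *C (x + L * L) - L = 0"
  proof (rule zero_if_N_le_tendsto_0)
    fix n
    have "N ((1/2) *C (x + L * L) - L)
        \<le> N ((1/2) *C (x + L * L) - y (Suc n)) + N (y (Suc n) - L)"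
      using N_triangle[of "(1/2) *C (x + L * L) - y (Suc n)" "y (Suc n) - L"] by simp
    also have "N ((1/2) *C (x + L * L) - y (Suc n)) = N (y (Suc n) - (1/2) *C (x + L * L))"
      using N_minus[of "y (Suc n) - (1/2) *C (x + L * L)"] by simp
    also have "\<dots> \<le> N (y n - L) * (N (y n) + N L) / 2"
      using step[of "y n" L] by (simp add: yS)
    also have "\<dots> \<le> N (y n - L) * (t + N L) / 2"
      using y_le[of n] N_nonneg by (intro divide_right_mono mult_left_mono) auto
    finally show "N ((1/2) *C (x + L * L) - L)
        \<le> N (y n - L) * ((t + N L) / 2) + N (y (Suc n) - L)" by simp
  next
    show "(\<lambda>n. N (y n - L) * ((t + N L) / 2) + N (y (Suc n) - L)) \<longlonglongrightarrow> 0"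
      using tendsto_add[OF lim LIMSEQ_Suc[OF L]] by (simp only: add_0_right)
  qed
  have y_comm: "z * y n = y n * z" if "z * x = x * z" for z n
  proof (induction n)
    case (Suc n)
    then have "z * (y n * y n) = y n * y n * z" by (metis mult.assoc)
    then show ?case using that by (simp add: yS star_simps distrib_left distrib_right)
  qed (simp add: y0)
  have y_adj: "adj (y n) = y n" for n
    by (induction n) (simp_all add: y0 yS star_simps x)
  have L_comm: "z * L = L * z" if "z * x = x * z" for z
  proof -
    have "z * L - L * z = 0"
    proof (rule zero_if_N_le_tendsto_0)
      fix n
      have "z * L - L * z = (y n - L) * z - z * (y n - L)"
        using y_comm[OF that, of n] by (simp add: algebra_simps)
      then show "N (z * L - L * z) \<le> N (y n - L) * (2 * N z)"
        using N_diff[of "(y n - L) * z" "z * (y n - L)"] N_mult[of "y n - L" z]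
          N_mult[of z "y n - L"] by (simp add: algebra_simps)
    qed (rule lim)
    then show ?thesis by simp
  qed
  have "adj L - L = 0"
  proof (rule zero_if_N_le_tendsto_0)
    fix n
    have "adj L - L = (y n - L) - adj (y n - L)" by (simp add: star_simps y_adj)
    then show "N (adj L - L) \<le> N (y n - L) * 2"
      using N_diff[of "y n - L" "adj (y n - L)"] by (simp only: N_adj)
  qed (rule lim)
  then have L_adj: "adj L = L" by simp
  have L_eq: "(1/2) *C (x + L * L) = L" using fixpoint by simp
  have "x + L * L = (1/2) *C (x + L * L) + (1/2) *C (x + L * L)"
    using scaleC_half_double[of "x + L * L"] by (simp only: scaleC_add_right)
  then have "x + L * L = L + L" by (simp only: L_eq)
  then have x_eq: "x = L + L - L * L" by (simp only: eq_diff_eq)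
  have square: "(1 - L) * (1 - L) = 1 - x" unfolding x_eq by (simp add: algebra_simps)
  have "adj (1 - L) = 1 - L" by (simp add: star_simps L_adj)
  moreover have "z * (1 - L) = (1 - L) * z" if "z * x = x * z" for z
    using L_comm[OF that] by (simp add: algebra_simps)
  ultimately show ?thesis using that[OF _ square] by blast
qed

text \<open>The hypotheses make \<open>h + \<i>k\<close> unitary, and \<open>h\<close> is its real part.\<close>

lemma N_le_1_if_squares_sum_1:
  assumes "adj h = h" "adj k = k" "h * k = k * h" "h * h + k * k = 1"
  shows "N h \<le> 1"
proof -
  let ?u = "h + \<i> *C k" and ?v = "h - \<i> *C k"
  have adj: "adj ?u = ?v" by (simp add: star_simps assms)
  have "adj ?u * ?u = 1"
    using assms(3,4) by (simp only: adj) (simp add: algebra_simps star_simps)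
  then have "(N ?u)\<^sup>2 = 1" using N_star[of ?u] N_one by simp
  then have u: "N ?u = 1" using N_nonneg[of ?u] by (simp add: power2_eq_1_iff)
  then have "N ?v = 1" using N_adj[of ?u] adj by simp
  moreover have "h = (1/2) *C (?u + ?v)" by (simp add: scaleC_half_double)
  ultimately show ?thesis
    using u N_scaleC[of "1/2" "?u + ?v"] N_triangle[of ?u ?v] by simp
qed

text \<open>A hermitian strict contraction is thus the real part of a unitary, a purely algebraic description
  that homomorphisms transport.\<close>

lemma hermitian_complement:
  assumes h: "adj h = h" "N h < 1"
  obtains k where "adj k = k" "h * k = k * h" "h * h + k * k = 1"
proof -
  have less: "N (h * h) < 1" using N_star[of h] h N_nonneg[of h] by (simp add: power_less_one_iff)
  have herm: "adj (h * h) = h * h" by (simp add: star_simps h)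
  obtain c where c: "adj c = c" "c * c = 1 - h * h"
    "\<And>z. z * (h * h) = (h * h) * z \<Longrightarrow> z * c = c * z"
    using sqrt_one_minus[OF herm less] by blast
  have "h * c = c * h" by (rule c(3)) (simp only: mult.assoc)
  moreover have "h * h + c * c = 1" by (simp only: c(2)) simp
  ultimately show ?thesis by (rule that[OF c(1)])
qed

end

text \<open>Homomorphisms preserve the relation \<open>h\<^sup>2 + k\<^sup>2 = 1\<close> between commuting hermitian elements, so images of
  hermitian strict contractions are contractions. The \<open>C\<^sup>*\<close>-identity extends the bound to all elements.\<close>

lemma star_hom_contractive:
  fixes \<pi> :: "'a::complex_star_algebra \<Rightarrow> 'c::complex_star_algebra"
  assumes "cstar_norm N" "cstar_norm N'"
    and hom: "\<And>x y. \<pi> (x + y) = \<pi> x + \<pi> y" "\<And>c x. \<pi> (c *C x) = c *C \<pi> x"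
      "\<And>x y. \<pi> (x * y) = \<pi> x * \<pi> y" "\<And>x. \<pi> (adj x) = adj (\<pi> x)" "\<pi> 1 = 1"
  shows "N' (\<pi> a) \<le> N a"
proof -
  interpret A: cstar_normed N by unfold_locales (rule assms)
  interpret C: cstar_normed N' by unfold_locales (rule assms)
  have less: "N' (\<pi> h) \<le> 1" if h: "adj h = h" "N h < 1" for h
  proof -
    obtain k where k: "adj k = k" "h * k = k * h" "h * h + k * k = 1"
      using A.hermitian_complement[OF h] by blast
    show ?thesis
    proof (rule C.N_le_1_if_squares_sum_1[of _ "\<pi> k"])
      show "adj (\<pi> h) = \<pi> h" "adj (\<pi> k) = \<pi> k"
        by (simp_all only: hom(4)[symmetric] h k(1))
      show "\<pi> h * \<pi> k = \<pi> k * \<pi> h" "\<pi> h * \<pi> h + \<pi> k * \<pi> k = 1"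
        by (simp_all only: hom(3)[symmetric] hom(1)[symmetric] k(2,3) hom(5))
    qed
  qed
  have herm: "N' (\<pi> h) \<le> N h" if h: "adj h = h" for h
  proof (rule field_le_epsilon)
    fix e :: real assume e: "e > 0"
    define s where "s = N h + e"
    have s: "s > 0" "N h < s" using A.N_nonneg[of h] e by (simp_all add: s_def)
    have "N' (\<pi> (complex_of_real (1 / s) *C h)) \<le> 1"
      by (rule less) (use s h in \<open>simp_all add: star_simps A.N_scaleC norm_divide\<close>)
    then have "N' (\<pi> h) \<le> s"
      using s by (simp add: hom(2) C.N_scaleC norm_divide)
    then show "N' (\<pi> h) \<le> N h + e" by (simp only: s_def)
  qed
  have "(N' (\<pi> a))\<^sup>2 = N' (\<pi> (adj a * a))" using C.N_star[of "\<pi> a"] hom by simp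
  also have "\<dots> \<le> N (adj a * a)" by (rule herm) (simp add: star_simps)
  also have "\<dots> = (N a)\<^sup>2" by (rule A.N_star)
  finally show ?thesis using A.N_nonneg by (rule power2_le_imp_le)
qed

section \<open>Positivity of states\<close>

context cstar_normed
begin

text \<open>The norm of \<open>h + \<i>t\<close> grows only like the root of \<open>N h\<^sup>2 + t\<^sup>2\<close>, which leaves no room for an imaginary part
  of \<open>f h\<close> when \<open>t\<close> is large with the sign of that part.\<close>

lemma state_hermitian_real:
  assumes f: "f \<in> states N" and h: "adj h = h"
  shows "Im (f h) = 0"
proof (rule ccontr)
  assume nz: "Im (f h) \<noteq> 0"
  have key: "(Re (f h))\<^sup>2 + (Im (f h) + t)\<^sup>2 \<le> (N h)\<^sup>2 + t\<^sup>2" for t :: real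
  proof -
    let ?z = "h + (\<i> * t) *C 1"
    have "adj ?z * ?z = h * h + (complex_of_real (t\<^sup>2)) *C 1"
      by (simp add: star_simps h algebra_simps power2_eq_square)
    then have "(N ?z)\<^sup>2 \<le> N h * N h + t\<^sup>2"
      using N_star[of ?z] N_triangle[of "h * h" "(complex_of_real (t\<^sup>2)) *C 1"] N_mult[of h h]
      by (simp add: N_scaleC N_one norm_power del: of_real_power)
    moreover have "(cmod (f ?z))\<^sup>2 \<le> (N ?z)\<^sup>2" using state_simps(4)[OF f] by (simp add: power_mono)
    moreover have "(cmod (f ?z))\<^sup>2 = (Re (f h))\<^sup>2 + (Im (f h) + t)\<^sup>2"
      by (simp add: state_simps[OF f] cmod_power2)
    ultimately show ?thesis by (simp add: power2_eq_square)
  qed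
  (* The choice of t makes the cross term 2 t Im (f h) exceed the square of N h by one. *)
  let ?b = "Im (f h)"
  have "(Re (f h))\<^sup>2 + ?b\<^sup>2 + 2 * ?b * (((N h)\<^sup>2 + 1) / (2 * ?b)) \<le> (N h)\<^sup>2"
    using key[of "((N h)\<^sup>2 + 1) / (2 * ?b)"] 
    unfolding power2_sum by linarith
  moreover have "2 * ?b * (((N h)\<^sup>2 + 1) / (2 * ?b)) = (N h)\<^sup>2 + 1" using nz by simp
  ultimately show False using zero_le_power2[of "Re (f h)"] zero_le_power2[of ?b] by linarith
qed

lemma state_adj:
  assumes f: "f \<in> states N"
  shows "f (adj a) = cnj (f a)"
proof -
  obtain h k where hk: "adj h = h" "adj k = k" and a: "a = h + \<i> *C k" "adj a = h - \<i> *C k"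
    by (rule hermitian_decomposition)
  show ?thesis
    by (subst a(2), subst a(1))
      (simp add: state_simps[OF f] complex_eq_iff state_hermitian_real[OF f hk(1)]
        state_hermitian_real[OF f hk(2)])
qed

text \<open>For a strict contraction, \<open>1 - h\<^sup>2\<close> is the square of a hermitian contraction, so its norm is at most \<open>1\<close>
  and \<open>f (1 - h\<^sup>2) \<le> 1\<close>.\<close>

lemma state_square_nonneg:
  assumes f: "f \<in> states N" and h: "adj h = h"
  shows "0 \<le> Re (f (h * h))"
proof -
  have small: "0 \<le> Re (f (g * g))" if g: "adj g = g" "N g < 1" for g
  proof -
    obtain k where k: "adj k = k" "g * k = k * g" "g * g + k * k = 1"
      using hermitian_complement g by blast
    have "N k \<le> 1" using N_le_1_if_squares_sum_1[of k g] k g by (simp add: add.commute)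
    then have "N (k * k) \<le> 1" using N_star[of k] k N_nonneg[of k] by (simp add: power_le_one)
    then have "cmod (f (k * k)) \<le> 1" using state_simps(4)[OF f, of "k * k"] by linarith
    moreover have "f (g * g) = 1 - f (k * k)"
      using state_simps(1)[OF f, of "g * g" "k * k"] k(3) state_simps(3)[OF f]
      by (simp add: algebra_simps)
    ultimately show ?thesis using complex_Re_le_cmod[of "f (k * k)"] by simp
  qed
  define s where "s = 1 / (N h + 1)"
  have s: "s > 0" "s * N h < 1" using N_nonneg[of h] by (simp_all add: s_def)
  have "0 \<le> Re (f ((complex_of_real s *C h) * (complex_of_real s *C h)))"
    by (rule small) (use s h in \<open>simp_all add: star_simps N_scaleC\<close>)
  then have "0 \<le> (s * s) * Re (f (h * h))" by (simp add: star_simps state_simps[OF f])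
  then show ?thesis using s by (metis mult_pos_pos zero_le_mult_iff not_le)
qed

lemma state_schwarz:
  assumes f: "f \<in> states N" and h: "adj h = h"
  shows "(Re (f h))\<^sup>2 \<le> Re (f (h * h))"
proof -
  (* Expanding the square gives the variance of h in the state f. *)
  let ?t = "complex_of_real (Re (f h))"
  let ?g = "h - ?t *C 1"
  have "adj ?g = ?g" by (simp add: star_simps h)
  then have "0 \<le> Re (f (?g * ?g))" by (rule state_square_nonneg[OF f])
  also have "?g * ?g = h * h - ?t *C h - ?t *C h + (?t * ?t) *C 1"
    by (simp add: star_simps algebra_simps)
  finally show ?thesis by (simp add: state_simps[OF f] power2_eq_square)
qed

text \<open>Where \<open>f\<close> is \<open>1\<close> on a projection \<open>p\<close>, it vanishes on everything with a factor \<open>q = 1 - p\<close> at one end. Indeed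
  \<open>p + t b q\<close> satisfies \<open>(p + t b q) (p + t b q)\<^sup>* = p + |t|\<^sup>2 b q b\<^sup>*\<close>, so its norm exceeds \<open>1\<close> only to second order in
  \<open>t\<close>, whereas \<open>f\<close> of it is \<open>1 + t f (b q)\<close>, which has a first-order term unless \<open>f (b q) = 0\<close>.\<close>

lemma state_compress:
  assumes f: "f \<in> states N" and p: "p * p = p" "adj p = p" "f p = 1"
  shows "f a = f (p * a * p)"
proof -
  let ?q = "1 - p"
  have N_proj: "N q \<le> 1" if "q * q = q" "adj q = q" for q
    using N_star[of q] that N_nonneg[of q] by (cases "N q = 0") (auto simp: power2_eq_square)
  have q: "?q * ?q = ?q" "adj ?q = ?q" "p * ?q = 0" "?q * p = 0"
    by (simp_all add: algebra_simps p star_simps)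
  have right0: "f (b * ?q) = 0" for b
  proof (rule ccontr)
    assume nz: "f (b * ?q) \<noteq> 0"
    define w where "w = f (b * ?q)"
    have bound: "(cmod (1 + t * w))\<^sup>2 \<le> 1 + (cmod t)\<^sup>2 * (N b)\<^sup>2" for t
    proof -
      let ?z = "p + t *C (b * ?q)"
      have "?z * adj ?z = p + (t * cnj t) *C (b * ?q * adj b)"
      proof -
        have adj: "adj ?z = p + cnj t *C (?q * adj b)" by (simp only: star_simps q(2) p(2))
        have "?z * adj ?z = p * p + cnj t *C ((p * ?q) * adj b) + t *C (b * (?q * p))
            + (t * cnj t) *C (b * (?q * ?q) * adj b)"
          by (simp only: adj distrib_left distrib_right scaleC_mult_left scaleC_mult_right
              scaleC_scaleC scaleC_add_right mult.assoc add.assoc add.left_commute mult.commute[of t])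
        then show ?thesis by (simp only: q p star_simps mult_zero_left mult_zero_right add_0_right)
      qed
      moreover have "N (b * ?q * adj b) \<le> (N b)\<^sup>2"
      proof -
        have "N (b * ?q * adj b) \<le> N (b * ?q) * N (adj b)" by (rule N_mult)
        also have "\<dots> \<le> (N b * N ?q) * N b"
          using N_mult[of b ?q] N_nonneg by (simp add: N_adj mult_right_mono)
        also have "\<dots> \<le> (N b * 1) * N b"
          using N_proj[OF q(1,2)] N_nonneg by (intro mult_right_mono mult_left_mono) auto
        finally show ?thesis by (simp add: power2_eq_square)
      qed
      moreover have "(N ?z)\<^sup>2 = N (?z * adj ?z)"
        using N_star[of "adj ?z"] by (simp only: adj_adj N_adj)
      ultimately have "(N ?z)\<^sup>2 \<le> 1 + (cmod t)\<^sup>2 * (N b)\<^sup>2"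
        using N_triangle[of p "(t * cnj t) *C (b * ?q * adj b)"] N_proj[OF p(1,2)]
          mult_left_mono[of "N (b * ?q * adj b)" "(N b)\<^sup>2" "(cmod t)\<^sup>2"]
        by (simp add: N_scaleC norm_mult power2_eq_square)
      moreover have "f ?z = 1 + t * w" using p by (simp only: state_simps[OF f] w_def)
      ultimately show ?thesis
        using power_mono[OF state_simps(4)[OF f, of ?z] norm_ge_zero, of 2] by simp
    qed
    (* The test value is t = s * cnj w, with s so small that the second-order term loses. *)
    define s where "s = 1 / ((N b)\<^sup>2 + 1)"
    have s: "s > 0" "s * (N b)\<^sup>2 < 1" by (simp_all add: s_def add_nonneg_pos)
    have w: "(cmod w)\<^sup>2 > 0" using nz by (simp add: w_def)
    have tw: "(complex_of_real s * cnj w) * w = complex_of_real (s * (cmod w)\<^sup>2)"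
      by (simp only: of_real_mult complex_norm_square mult.assoc mult.commute[of w])
    have "(1 + s * (cmod w)\<^sup>2)\<^sup>2 \<le> 1 + (s * cmod w)\<^sup>2 * (N b)\<^sup>2"
    proof -
      have "cmod (1 + complex_of_real (s * (cmod w)\<^sup>2)) = 1 + s * (cmod w)\<^sup>2"
        using s by (metis abs_of_nonneg add_nonneg_nonneg mult_nonneg_nonneg norm_of_real
            of_real_1 of_real_add less_imp_le zero_le_one zero_le_power2)
      with bound[of "complex_of_real s * cnj w"] s show ?thesis
        by (simp only: tw) (simp add: norm_mult)
    qed
    moreover have "(1 + s * (cmod w)\<^sup>2)\<^sup>2 = 1 + 2 * s * (cmod w)\<^sup>2 + (s * (cmod w)\<^sup>2)\<^sup>2"
      "(s * cmod w)\<^sup>2 * (N b)\<^sup>2 = s * (cmod w)\<^sup>2 * (s * (N b)\<^sup>2)" by algebra+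
    ultimately have "2 * s * (cmod w)\<^sup>2 \<le> s * (cmod w)\<^sup>2 * (s * (N b)\<^sup>2)"
      using zero_le_power2[of "s * (cmod w)\<^sup>2"] by linarith
    also have "\<dots> \<le> s * (cmod w)\<^sup>2 * 1" using s w by (intro mult_left_mono) auto
    finally show False using s w by simp
  qed
  have left0: "f (?q * b) = 0" for b
    using right0[of "adj b"] state_adj[OF f, of "adj b * ?q"] q by (simp add: adj_mult adj_adj)
  have "a = p * a * p + p * a * ?q + ?q * a" by (simp add: algebra_simps)
  then have "f a = f (p * a * p) + f (p * a * ?q) + f (?q * a)"
    by (metis state_simps(1)[OF f])
  then show ?thesis using right0[of "p * a"] left0[of a] by simp
qed

end

section \<open>States on two-by-two matrices\<close>

definition diag2 :: "'a::complex_star_algebra \<Rightarrow> 'a mat2" where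
  "diag2 b = Mat2 b 0 0 b"

definition corner :: "'a::complex_star_algebra \<Rightarrow> 'a mat2" where
  "corner b = Mat2 0 b 0 0"

text \<open>In tensor notation this is \<open>b \<otimes> p\<close>, where \<open>p\<close> is the projection with all entries \<open>1/2\<close>.\<close>

definition amplify :: "'a::complex_star_algebra \<Rightarrow> 'a mat2" where
  "amplify b = (1/2) *C Mat2 b b b b"

text \<open>Compressing \<open>a\<close> by the projection \<open>p\<close> gives \<open>mean a \<otimes> p\<close>; see \<open>amplify_mean\<close>.\<close>

definition mean :: "'a::complex_star_algebra mat2 \<Rightarrow> 'a" where
  "mean a = (1/2) *C (m11 a + m12 a + m21 a + m22 a)"

lemma amplify_simps:
  shows "amplify (b + c) = amplify b + amplify c" "amplify (z *C b) = z *C amplify b"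
    "amplify (b - c) = amplify b - amplify c" "adj (amplify b) = amplify (adj b)"
    "amplify b * amplify c = amplify (b * c)"
proof -
  have "(1/4) *C y + (1/4) *C y = (1/2) *C y" for y :: 'a
    using scaleC_add_left[of "1/4" "1/4" y] by simp
  then show "amplify b * amplify c = amplify (b * c)"
    by (simp add: amplify_def mat2_defs star_simps)
qed (simp_all add: amplify_def mat2_defs star_simps mult.commute)

lemma mean_amplify: "mean (amplify b) = b"
proof -
  have "(1/4) *C y + (1/4) *C y + (1/4) *C y + (1/4) *C y = y" for y :: 'a
    by (simp add: scaleC_add_left[symmetric] star_simps)
  then show ?thesis by (simp add: mean_def amplify_def mat2_defs star_simps)
qed

lemma mean_diag2: "mean (diag2 b) = b"
  by (simp add: mean_def diag2_def scaleC_half_double)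

lemma amplify_mean: "amplify 1 * a * amplify 1 = amplify (mean a)"
  by (simp add: amplify_def mean_def mat2_defs star_simps add_ac)

lemma Phi_eq_mean:
  assumes "f \<in> states N"
  shows "Phi f a = f (mean a)"
  by (simp add: Phi_def mean_def state_simps[OF assms])

text \<open>The matrices \<open>b \<otimes> p\<close> form a copy of the coefficient algebra, with unit \<open>p\<close>. The copy is complete because
  compression by \<open>p\<close> is continuous and carries limits taken in the matrix algebra back into it.\<close>

lemma cstar_norm_amplify:
  assumes "cstar_norm N"
  shows "cstar_norm (\<lambda>b. N (amplify b))"
proof -
  interpret cstar_normed N by unfold_locales (rule assms)
  have "amplify b = 0 \<longleftrightarrow> b = 0" for b :: 'a
  proof
    assume "amplify b = 0"
    then have "b = mean 0" using mean_amplify[of b] by simp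
    then show "b = 0" by (simp add: mean_def zero_mat2_def star_simps)
  qed (simp add: amplify_def mat2_defs star_simps)
  moreover have "\<exists>L. (\<lambda>n. N (amplify (X n - L))) \<longlonglongrightarrow> 0"
    if cauchy: "\<forall>e>0. \<exists>n0. \<forall>m\<ge>n0. \<forall>n\<ge>n0. N (amplify (X m - X n)) < e" for X :: "nat \<Rightarrow> 'a"
  proof -
    obtain Y where Y: "(\<lambda>n. N (amplify (X n) - Y)) \<longlonglongrightarrow> 0"
      using N_complete[of "\<lambda>n. amplify (X n)"] cauchy[unfolded amplify_simps(3)] by blast
    let ?C = "N (amplify 1) * N (amplify 1)"
    have le: "N (amplify (X n - mean Y)) \<le> ?C * N (amplify (X n) - Y)" for n
    proof -
      have "amplify (X n - mean Y) = amplify 1 * (amplify (X n) - Y) * amplify 1"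
        using amplify_mean[of Y] amplify_simps(5)[of 1 "X n"] amplify_simps(5)[of "X n" 1]
        by (simp add: amplify_simps algebra_simps)
      then show ?thesis
        using N_mult[of "amplify 1 * (amplify (X n) - Y)" "amplify 1"]
          mult_right_mono[OF N_mult[of "amplify 1" "amplify (X n) - Y"], of "N (amplify 1)"]
        by (simp add: N_nonneg mult_ac)
    qed
    have lim: "(\<lambda>n. ?C * N (amplify (X n) - Y)) \<longlonglongrightarrow> 0"
      using tendsto_mult_right_zero[OF Y] .
    have "(\<lambda>n. N (amplify (X n - mean Y))) \<longlonglongrightarrow> 0"
      by (rule Lim_null_comparison[OF _ lim]) (simp add: le N_nonneg)
    then show ?thesis by blast
  qed
  ultimately show ?thesis
    unfolding cstar_norm_def
    by (intro conjI allI impI)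
      (simp_all add: amplify_simps N_nonneg N_eq_0 N_triangle N_scaleC
        N_star[of "amplify _", unfolded amplify_simps] N_mult[of "amplify _" "amplify _", unfolded amplify_simps])
qed

text \<open>The point is contractivity. The identity map is contractive from the norm \<open>N (b \<otimes> p)\<close> to \<open>K b\<close>, both
  being \<open>C\<^sup>*\<close>-norms on the coefficient algebra, and compression by \<open>p\<close> does not increase \<open>N\<close>.\<close>

lemma Phi_state:
  assumes "cstar_norm K" "cstar_norm N" and f: "f \<in> states K"
  shows "Phi f \<in> states N"
proof -
  interpret cstar_normed N by unfold_locales (rule assms)
  have p: "N (amplify 1) \<le> 1"
  proof -
    have "(N (amplify 1))\<^sup>2 = N (amplify 1)"
      using N_star[of "amplify 1"] by (simp add: amplify_simps star_simps)
    then show ?thesis by (cases "N (amplify 1) = 0") (simp_all add: power2_eq_square)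
  qed
  have "cmod (f (mean a)) \<le> N a" for a
  proof -
    have "cmod (f (mean a)) \<le> K (mean a)" by (rule state_simps(4)[OF f])
    also have "\<dots> \<le> N (amplify (mean a))"
      by (rule star_hom_contractive[where \<pi> = id, OF cstar_norm_amplify[OF assms(2)] assms(1),
            unfolded id_apply]) (rule refl)+
    also have "\<dots> \<le> N (amplify 1) * N a * N (amplify 1)"
      unfolding amplify_mean[symmetric]
      using N_mult[of "amplify 1 * a" "amplify 1"]
        mult_right_mono[OF N_mult[of "amplify 1" a] N_nonneg[of "amplify 1"]] by linarith
    also have "\<dots> \<le> 1 * N a * 1"
      using p N_nonneg by (intro mult_mono) auto
    finally show ?thesis by simp
  qed
  moreover have "mean (a + b) = mean a + mean b" "mean (c *C a) = c *C mean a" "mean 1 = (1 :: 'a)"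
    for a b :: "'a mat2" and c
    using scaleC_half_double[of "1 :: 'a"] by (simp_all add: mean_def mat2_defs star_simps add_ac mult.commute)
  ultimately show ?thesis
    unfolding states_def by (simp add: Phi_eq_mean[OF f] state_simps(1-3)[OF f])
qed

lemma state_diag2:
  assumes "cstar_norm K" "cstar_norm N" and \<Psi>: "\<Psi> \<in> states N"
  shows "(\<lambda>b. \<Psi> (diag2 b)) \<in> states K"
proof -
  have hom: "diag2 (x + y) = diag2 x + diag2 y" "diag2 (c *C x) = c *C diag2 x"
    "diag2 (x * y) = diag2 x * diag2 y" "diag2 (adj x) = adj (diag2 x)" "diag2 1 = (1 :: 'a mat2)"
    for x y :: 'a and c
    by (simp_all add: diag2_def mat2_defs star_simps)
  have "cmod (\<Psi> (diag2 b)) \<le> K b" for b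
    using state_simps(4)[OF \<Psi>, of "diag2 b"]
      star_hom_contractive[where \<pi> = diag2, OF assms(1,2) hom, of b] by linarith
  then show ?thesis unfolding states_def by (simp add: hom state_simps(1-3)[OF \<Psi>])
qed

lemma Phi_diag2:
  assumes "f \<in> states K"
  shows "Phi f (diag2 b) = f b"
  by (simp add: Phi_eq_mean[OF assms] mean_diag2)

lemma Phi_corner:
  assumes "f \<in> states K"
  shows "Phi f (corner b) = f b / 2"
  by (simp add: Phi_def corner_def state_simps[OF assms])

text \<open>Since \<open>p = (1 + E\<^sub>1\<^sub>2 + E\<^sub>2\<^sub>1) / 2\<close>, the hypothesis says \<open>\<Psi> p = 1\<close>. Compressing both \<open>a\<close> and \<open>diag (mean a, mean a)\<close>
  by \<open>p\<close> gives \<open>mean a \<otimes> p\<close>.\<close>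

lemma state_eq_Phi:
  assumes "cstar_norm N" and \<Psi>: "\<Psi> \<in> states N" and half: "Re (\<Psi> (corner 1)) = 1/2"
  shows "\<Psi> = Phi (\<lambda>b. \<Psi> (diag2 b))"
proof
  fix a
  interpret cstar_normed N by unfold_locales (rule assms)
  have amp: "amplify 1 = (1/2) *C (1 + (corner 1 + adj (corner (1::'a))))"
    by (simp add: amplify_def corner_def mat2_defs star_simps)
  have one: "\<Psi> (amplify 1) = 1"
    unfolding amp using half by (simp add: state_simps[OF \<Psi>] state_adj[OF \<Psi>] complex_eq_iff)
  have comp: "\<Psi> a = \<Psi> (amplify (mean a))" for a
    using state_compress[OF \<Psi> _ _ one] by (simp add: amplify_simps star_simps amplify_mean)
  have diag: "\<Psi> (diag2 b) = \<Psi> (amplify b)" for b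
    using comp[of "diag2 b"] by (simp add: mean_diag2)
  have "(\<lambda>b. \<Psi> (amplify b)) = (\<lambda>b. \<Psi> (diag2 b))" by (simp add: diag)
  moreover have "Phi (\<lambda>b. \<Psi> (amplify b)) a = \<Psi> (amplify (mean a))"
    by (simp add: Phi_def mean_def amplify_simps state_simps[OF \<Psi>])
  ultimately show "\<Psi> a = Phi (\<lambda>b. \<Psi> (diag2 b)) a" using comp[of a] by simp
qed

section \<open>Unique extensions\<close>

lemma triangular_eq: "Mat2 (c *C 1) x 0 (c *C 1) = c *C 1 + corner x"
  by (simp add: corner_def mat2_defs star_simps)

lemma extensions_of_Phi:
  assumes M: "unital_subspace M" and "cstar_norm K" "cstar_norm N" and \<omega>: "\<omega> \<in> states K"
  shows "{\<Psi> \<in> states N. \<forall>a\<in>triangular_algebra M. \<Psi> a = Phi \<omega> a}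
    = Phi ` {\<psi> \<in> states K. \<forall>x\<in>M. \<psi> x = \<omega> x}"
proof (intro equalityI subsetI)
  fix \<Psi> assume "\<Psi> \<in> {\<Psi> \<in> states N. \<forall>a\<in>triangular_algebra M. \<Psi> a = Phi \<omega> a}"
  then have \<Psi>: "\<Psi> \<in> states N" and ext: "\<And>a. a \<in> triangular_algebra M \<Longrightarrow> \<Psi> a = Phi \<omega> a" by auto
  have corner: "\<Psi> (corner x) = \<omega> x / 2" if "x \<in> M" for x
  proof -
    have "corner x = Mat2 (0 *C 1) x 0 (0 *C 1)" by (simp add: corner_def star_simps)
    then have "corner x \<in> triangular_algebra M" using that unfolding triangular_algebra_def by blast
    then show ?thesis using ext Phi_corner[OF \<omega>] by simp
  qed
  have "1 \<in> M" using M by (simp add: unital_subspace_def)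
  then have c1: "\<Psi> (corner 1) = 1 / 2" using corner[of 1] by (simp only: state_simps(3)[OF \<omega>])
  have eq: "\<Psi> = Phi (\<lambda>b. \<Psi> (diag2 b))"
    by (rule state_eq_Phi[OF assms(3) \<Psi>]) (simp add: c1)
  have st: "(\<lambda>b. \<Psi> (diag2 b)) \<in> states K" by (rule state_diag2[OF assms(2,3) \<Psi>])
  have "\<Psi> (diag2 x) = \<omega> x" if "x \<in> M" for x
    using corner[OF that] Phi_corner[OF st, of x] eq by (metis divide_cancel_right zero_neq_numeral)
  with eq st show "\<Psi> \<in> Phi ` {\<psi> \<in> states K. \<forall>x\<in>M. \<psi> x = \<omega> x}" by blast
next
  fix \<Psi> assume "\<Psi> \<in> Phi ` {\<psi> \<in> states K. \<forall>x\<in>M. \<psi> x = \<omega> x}"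
  then obtain \<psi> where \<psi>: "\<psi> \<in> states K" "\<And>x. x \<in> M \<Longrightarrow> \<psi> x = \<omega> x" "\<Psi> = Phi \<psi>" by auto
  have "Phi \<psi> a = Phi \<omega> a" if "a \<in> triangular_algebra M" for a
    using that \<psi>(2) unfolding triangular_algebra_def
    by (auto simp: Phi_def state_simps[OF \<psi>(1)] state_simps[OF \<omega>])
  then show "\<Psi> \<in> {\<Psi> \<in> states N. \<forall>a\<in>triangular_algebra M. \<Psi> a = Phi \<omega> a}"
    using \<psi>(3) Phi_state[OF assms(2,3) \<psi>(1)] by simp
qed

lemma inj_on_Phi: "inj_on Phi (states K)"
proof (rule inj_onI)
  fix f g :: "'a \<Rightarrow> complex"
  assume fg: "f \<in> states K" "g \<in> states K" "Phi f = Phi g"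
  show "f = g"
  proof
    fix b
    show "f b = g b" using Phi_diag2[OF fg(1), of b] Phi_diag2[OF fg(2), of b] fg(3) by simp
  qed
qed

text \<open>The two sets of extensions correspond to each other under the injective map \<open>Phi\<close>.\<close>

lemma unique_extension_iff:
  assumes "unital_subspace M" "cstar_norm K" "cstar_norm N" "\<omega> \<in> states K"
  shows "has_unique_state_extension K M \<omega>
    \<longleftrightarrow> has_unique_state_extension N (triangular_algebra M) (Phi \<omega>)"
proof -
  let ?S = "{\<psi> \<in> states K. \<forall>x\<in>M. \<psi> x = \<omega> x}"
  have card1: "(\<exists>!g. g \<in> states L \<and> P g) \<longleftrightarrow> is_singleton {g \<in> states L. P g}"
    for L :: "'c::complex_star_algebra \<Rightarrow> real" and P
    unfolding is_singleton_def Ex1_def set_eq_iff mem_Collect_eq singleton_iff by blast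
  have "inj_on Phi ?S" by (rule inj_on_subset[OF inj_on_Phi]) auto
  then have "is_singleton (Phi ` ?S) \<longleftrightarrow> is_singleton ?S"
    by (simp add: is_singleton_altdef card_image)
  then show ?thesis
    unfolding has_unique_state_extension_def card1 extensions_of_Phi[OF assms] by simp
qed

section \<open>Peak states\<close>

lemma peak_state_of_peak_Phi:
  assumes M: "unital_subspace M" and "cstar_norm K" "cstar_norm N" and \<omega>: "\<omega> \<in> states K"
    and peak: "peak_state N (triangular_algebra M) (Phi \<omega>)"
  shows "peak_state K M \<omega>"
proof -
  obtain c x where x: "x \<in> M" and one: "Phi \<omega> (c *C 1 + corner x) = 1"
    and lt: "\<And>\<Psi>. \<Psi> \<in> states N \<Longrightarrow> \<Psi> \<noteq> Phi \<omega> \<Longrightarrow> cmod (\<Psi> (c *C 1 + corner x)) < 1"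
    using peak unfolding peak_state_def triangular_algebra_def by (auto simp: triangular_eq)
  let ?y = "c *C 1 + (1/2) *C x"
  have Phi: "Phi f (c *C 1 + corner x) = f ?y" if "f \<in> states K" for f
    using state_simps[OF Phi_state[OF assms(2,3) that]]
    by (simp add: Phi_corner[OF that] state_simps[OF that])
  have "?y \<in> M" using M x by (simp add: unital_subspace_def)
  moreover have "\<omega> ?y = 1" using one Phi[OF \<omega>] by simp
  moreover have "cmod (f ?y) < 1" if "f \<in> states K" "f \<noteq> \<omega>" for f
    using lt[OF Phi_state[OF assms(2,3) that(1)]] Phi[OF that(1)] that
      inj_onD[OF inj_on_Phi _ that(1) \<omega>] by auto
  ultimately show ?thesis using \<omega> unfolding peak_state_def by blast
qed

section \<open>Faces of the state space\<close>

context cstar_normed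
begin

text \<open>A convex decomposition of an element of a face stays in the face, so a functional that is constant
  on the face takes the same value on all parts of the decomposition.\<close>

definition state_face :: "('a \<Rightarrow> complex) set \<Rightarrow> bool" where
  "state_face K \<longleftrightarrow> K \<subseteq> states N \<and>
     (\<forall>f\<in>K. \<forall>g\<in>states N. \<forall>h\<in>states N. \<forall>t. 0 < t \<longrightarrow> t < 1 \<longrightarrow>
        (\<forall>x. f x = of_real t * g x + of_real (1 - t) * h x) \<longrightarrow> g \<in> K \<and> h \<in> K)"

definition exposed :: "'a \<Rightarrow> ('a \<Rightarrow> complex) set \<Rightarrow> ('a \<Rightarrow> complex) set" where
  "exposed a K = {f \<in> K. \<forall>g\<in>K. Re (g a) \<le> Re (f a)}"

text \<open>This is the Banach-Alaoglu argument: the topology of pointwise convergence is the product topology,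
  and the states are a closed subset of a product of discs.\<close>

lemma compact_states: "compact (states N)"
proof -
  let ?B = "PiE UNIV (\<lambda>x. cball 0 (N x)) :: ('a \<Rightarrow> complex) set"
  have "compact ?B"
    using compactin_PiE[of "\<lambda>_. euclidean" "UNIV :: 'a set" "\<lambda>x. cball (0::complex) (N x)"]
    by (simp add: euclidean_product_topology)
  moreover have "closed (states N)"
    unfolding states_def
    by (intro closed_Collect_conj closed_Collect_all closed_Collect_eq closed_Collect_le
        continuous_intros continuous_on_product_coordinates)
  moreover have "states N = ?B \<inter> states N"
    using state_simps(4) by (auto simp: PiE_UNIV_domain)
  ultimately show ?thesis using compact_Int_closed by metis
qed

lemma exposed_compact_nonempty:
  assumes "compact K" "K \<noteq> {}"
  shows "compact (exposed a K)" "exposed a K \<noteq> {}"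
proof -
  have cont: "continuous_on S (\<lambda>f :: 'a \<Rightarrow> complex. Re (f a))" for S
    by (intro continuous_intros continuous_on_product_then_coordinatewise continuous_on_id)
  obtain f where f: "f \<in> K" "\<And>g. g \<in> K \<Longrightarrow> Re (g a) \<le> Re (f a)"
    using continuous_attains_sup[OF assms cont] by blast
  then show "exposed a K \<noteq> {}" by (auto simp: exposed_def)
  have "exposed a K = K \<inter> {g. Re (f a) \<le> Re (g a)}"
  proof (intro equalityI subsetI)
    fix h assume "h \<in> K \<inter> {g. Re (f a) \<le> Re (g a)}"
    then show "h \<in> exposed a K" using f(2) by (auto simp: exposed_def intro: order.trans)
  qed (use f(1) in \<open>simp add: exposed_def\<close>)
  moreover have "closed {g :: 'a \<Rightarrow> complex. Re (f a) \<le> Re (g a)}"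
    by (intro closed_Collect_le continuous_on_const cont)
  ultimately show "compact (exposed a K)" using assms(1) compact_Int_closed by metis
qed

lemma exposed_face:
  assumes "state_face K"
  shows "state_face (exposed a K)"
  unfolding state_face_def
proof (intro conjI subsetI ballI allI impI)
  show "f \<in> states N" if "f \<in> exposed a K" for f
    using that assms unfolding exposed_def state_face_def by blast
next
  fix f g h :: "'a \<Rightarrow> complex" and t :: real
  assume f: "f \<in> exposed a K" and gh: "g \<in> states N" "h \<in> states N" and t: "0 < t" "t < 1"
    and eq: "\<forall>x. f x = of_real t * g x + of_real (1 - t) * h x"
  have fK: "f \<in> K" and max: "\<And>k. k \<in> K \<Longrightarrow> Re (k a) \<le> Re (f a)"
    using f by (auto simp: exposed_def)
  have "g \<in> K \<and> h \<in> K"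
    using assms fK gh t eq unfolding state_face_def by blast
  then have gK: "g \<in> K" and hK: "h \<in> K" by auto
  have "f a = of_real t * g a + of_real (1 - t) * h a" using eq by blast
  then have "Re (f a) = t * Re (g a) + (1 - t) * Re (h a)" by simp
  then have "t * (Re (f a) - Re (g a)) + (1 - t) * (Re (f a) - Re (h a)) = 0"
    by (simp add: algebra_simps)
  moreover have "0 \<le> t * (Re (f a) - Re (g a))" "0 \<le> (1 - t) * (Re (f a) - Re (h a))"
    using t max[OF gK] max[OF hK] by simp_all
  ultimately have "t * (Re (f a) - Re (g a)) = 0" "(1 - t) * (Re (f a) - Re (h a)) = 0"
    by linarith+
  then have "Re (g a) = Re (f a)" "Re (h a) = Re (f a)" using t by simp_all
  then show "g \<in> exposed a K" "h \<in> exposed a K"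
    using gK hK max by (auto simp: exposed_def)
qed

lemma state_face_states: "state_face (states N)"
  by (auto simp: state_face_def)

section \<open>Commutative algebras\<close>

text \<open>This is the state with density \<open>c\<^sup>2\<close> with respect to \<open>f\<close>. For hermitian \<open>h\<close> with \<open>N h < 1\<close> and \<open>d\<^sup>2 = 1 - h\<close>,
  the element \<open>c\<^sup>2 (1 - h) = (c d)\<^sup>2\<close> is a hermitian square, so \<open>f (c\<^sup>2 h) \<le> f (c\<^sup>2)\<close>. A rotation by a scalar reduces the
  norm bound for general elements to this.\<close>

lemma weighted_state:
  assumes comm: "\<And>x y :: 'a. x * y = y * x"
    and f: "f \<in> states N" and c: "adj c = c" and t: "0 < t" "f (c * c) = of_real t"
  shows "(\<lambda>b. f (c * c * b) / of_real t) \<in> states N"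
proof -
  let ?F = "\<lambda>b. f (c * c * b)"
  have F: "?F (x + y) = ?F x + ?F y" "?F (z *C x) = z * ?F x" for x y z
    by (simp_all add: distrib_left scaleC_mult_right state_simps(1,2)[OF f])
  have small: "Re (?F h) \<le> t" if h: "adj h = h" "N h < 1" for h
  proof -
    obtain d where d: "adj d = d" "d * d = 1 - h"
      using sqrt_one_minus[OF h] by blast
    have "adj (c * d) = c * d" using c d comm by (simp add: adj_mult)
    then have "0 \<le> Re (f ((c * d) * (c * d)))" by (rule state_square_nonneg[OF f])
    also have "(c * d) * (c * d) = c * c * (d * d)" by (metis comm mult.assoc)
    also have "\<dots> = c * c - c * c * h" by (simp only: d right_diff_distrib mult_1_right)
    finally show ?thesis by (simp add: state_simps(7)[OF f] t)
  qed
  have herm: "Re (?F h) \<le> t * N h" if h: "adj h = h" for h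
  proof (rule field_le_epsilon)
    fix e :: real assume e: "e > 0"
    define s where "s = N h + e / t"
    have s: "s > 0" "N h < s" using N_nonneg[of h] e t by (simp_all add: s_def add_nonneg_pos)
    have "Re (?F (complex_of_real (1 / s) *C h)) \<le> t"
      by (rule small) (use s h in \<open>simp_all add: star_simps N_scaleC norm_divide\<close>)
    then have "Re (?F h) / s \<le> t" by (simp only: F Re_complex_of_real times_complex.sel Im_complex_of_real) simp
    then have "Re (?F h) \<le> t * s" using s by (simp add: pos_divide_le_eq)
    then show "Re (?F h) \<le> t * N h + e" using t by (simp add: s_def distrib_left)
  qed
  have "cmod (?F b) \<le> t * N b" for b
  proof (cases "?F b = 0")
    case False
    (* Rotating b makes F real and positive there, so that F sees only the hermitian part. *)
    define u where "u = cnj (?F b) / cmod (?F b)"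
    have u: "cmod u = 1" using False by (simp add: u_def norm_divide)
    have "u * ?F b = cmod (?F b)"
      using False by (simp add: u_def mult.commute[of "cnj _"] complex_norm_square[symmetric] power2_eq_square)
    define v where "v = u *C b"
    have Fv: "?F v = cmod (?F b)" unfolding v_def F by fact
    have "?F (adj v) = cnj (?F v)"
      using c comm by (simp add: state_adj[OF f, symmetric] adj_mult mult.assoc)
    then have "?F (adj v) = cmod (?F b)" by (simp add: Fv)
    then have "?F ((1/2) *C (v + adj v)) = cmod (?F b)"
      by (simp only: F Fv) simp
    moreover have "Re (?F ((1/2) *C (v + adj v))) \<le> t * N ((1/2) *C (v + adj v))"
      by (rule herm) (simp add: star_simps add.commute)
    moreover have "N ((1/2) *C (v + adj v)) \<le> N b"
      using N_triangle[of v "adj v"] u by (simp add: N_scaleC N_adj v_def)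
    then have "t * N ((1/2) *C (v + adj v)) \<le> t * N b" using t by simp
    ultimately show ?thesis by (simp only: Re_complex_of_real)
  qed (use t N_nonneg in simp)
  then have "cmod (?F b / of_real t) \<le> N b" for b
    using t by (simp add: norm_divide pos_divide_le_eq mult.commute)
  then show ?thesis
    using t unfolding states_def by (simp add: F add_divide_distrib)
qed

text \<open>For \<open>N k < 1\<close> the densities \<open>(1 + k) / 2\<close> and \<open>(1 - k) / 2\<close> are hermitian squares that sum to \<open>1\<close>, so \<open>f\<close> is
  a convex combination of the two weighted states. The first one agrees with \<open>f\<close> at \<open>x\<close> by
  hypothesis, which says \<open>f ((1 + k) x) = f (1 + k) f x\<close>.\<close>

lemma multiplicative_if_indecomposable:
  assumes comm: "\<And>x y :: 'a. x * y = y * x"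
    and f: "f \<in> states N"
    and indec: "\<And>g h t. \<lbrakk>g \<in> states N; h \<in> states N; 0 < t; t < 1;
        \<forall>y. f y = of_real t * g y + of_real (1 - t) * h y\<rbrakk> \<Longrightarrow> g x = f x"
    and h: "adj h = h"
  shows "f (h * x) = f h * f x"
proof -
  have small: "f (k * x) = f k * f x" if k: "adj k = k" "N k < 1" for k
  proof -
    have neg: "adj (- k) = - k" "N (- k) < 1" using k by (simp_all add: star_simps N_minus)
    obtain c where c: "adj c = c" "c * c = 1 - (- k)"
      using sqrt_one_minus[OF neg] by blast
    obtain d where d: "adj d = d" "d * d = 1 - k"
      using sqrt_one_minus[OF k] by blast
    define r where "r = Re (f k)"
    have fk: "f k = of_real r" using state_hermitian_real[OF f k(1)] by (simp add: r_def complex_eq_iff)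
    have r: "\<bar>r\<bar> < 1"
      using state_simps(4)[OF f, of k] k(2) by (simp add: fk)
    let ?c = "(1 / complex_of_real (sqrt 2)) *C c" and ?d = "(1 / complex_of_real (sqrt 2)) *C d"
    define t where "t = (1 + r) / 2"
    have t: "0 < t" "t < 1" using r by (simp_all add: t_def abs_less_iff)
    have half: "(1 / complex_of_real (sqrt 2)) * (1 / complex_of_real (sqrt 2)) = 1 / 2"
      by (simp flip: of_real_mult)
    have cc: "?c * ?c = (1/2) *C (1 + k)" and dd: "?d * ?d = (1/2) *C (1 - k)"
      using c d by (simp_all only: scaleC_mult_left scaleC_mult_right scaleC_scaleC half) simp_all
    have fcc: "f (?c * ?c) = of_real t" and fdd: "f (?d * ?d) = of_real (1 - t)"
      by (simp_all only: cc dd state_simps[OF f] fk t_def) (simp_all add: field_simps)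
    let ?g = "\<lambda>b. f (?c * ?c * b) / of_real t" and ?h = "\<lambda>b. f (?d * ?d * b) / of_real (1 - t)"
    have "?g \<in> states N" "?h \<in> states N"
      using weighted_state[OF comm f _ t(1) fcc] weighted_state[OF comm f _ _ fdd] t c d
      by (simp_all add: star_simps)
    moreover have "\<forall>y. f y = of_real t * ?g y + of_real (1 - t) * ?h y"
    proof
      fix y
      have "?c * ?c * y + ?d * ?d * y = y"
        unfolding cc dd using scaleC_half_double[of y]
        by (simp add: star_simps algebra_simps)
      then have "f (?c * ?c * y) + f (?d * ?d * y) = f y"
        by (simp only: state_simps(1)[OF f, symmetric])
      moreover have "of_real t * (X / complex_of_real t) = X"
        "of_real (1 - t) * (X / complex_of_real (1 - t)) = X" for X
        using t by simp_all
      ultimately show "f y = of_real t * ?g y + of_real (1 - t) * ?h y"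
        by (simp only:)
    qed
    ultimately have "?g x = f x" using indec t by blast
    then have "f (?c * ?c * x) = of_real t * f x" using t by (simp add: field_simps)
    moreover have "f (?c * ?c * x) = (f x + f (k * x)) / 2"
      unfolding cc by (simp add: state_simps[OF f] scaleC_mult_left distrib_right)
    ultimately show ?thesis by (simp add: t_def fk field_simps)
  qed
  define s where "s = 1 / (N h + 1)"
  have s: "s > 0" "s * N h < 1" using N_nonneg[of h] by (simp_all add: s_def)
  have "f ((complex_of_real s *C h) * x) = f (complex_of_real s *C h) * f x"
    by (rule small) (use s h in \<open>simp_all add: star_simps N_scaleC\<close>)
  then show ?thesis using s by (simp add: scaleC_mult_left state_simps[OF f])
qed

text \<open>Think of the character of largest modulus at \<open>x\<close> and, among those, of least real part. A state that
  maximises \<open>x\<^sup>* x\<close>, then \<open>- Re x\<close>, then \<open>- Im x\<close> serves the same purpose. All states in the final face agree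
  at \<open>x\<close>, so \<open>f\<close> is multiplicative against \<open>x\<close> and \<open>f (x\<^sup>* x) = |f x|\<^sup>2\<close> is the maximum of \<open>x\<^sup>* x\<close> over all states.\<close>

lemma dominating_state:
  assumes comm: "\<And>x y :: 'a. x * y = y * x" and nonempty: "states N \<noteq> {}"
  obtains f where "f \<in> states N"
    and "\<And>g. g \<in> states N \<Longrightarrow> Re (g (adj x * x)) \<le> (cmod (f x))\<^sup>2"
    and "\<And>g. g \<in> states N \<Longrightarrow> Re (g (adj x * x)) = (cmod (f x))\<^sup>2 \<Longrightarrow> Re (f x) \<le> Re (g x)"
proof -
  define K1 where "K1 = exposed (adj x * x) (states N)"
  define K2 where "K2 = exposed (- x) K1"
  define K3 where "K3 = exposed (\<i> *C x) K2"
  have K1: "compact K1" "K1 \<noteq> {}" "state_face K1"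
    unfolding K1_def using exposed_compact_nonempty[OF compact_states nonempty]
      exposed_face[OF state_face_states] by auto
  have K2: "compact K2" "K2 \<noteq> {}" "state_face K2"
    unfolding K2_def using exposed_compact_nonempty[OF K1(1,2)] exposed_face[OF K1(3)] by auto
  have K3: "K3 \<noteq> {}" "state_face K3"
    unfolding K3_def using exposed_compact_nonempty[OF K2(1,2)] exposed_face[OF K2(3)] by auto
  then obtain f where f3: "f \<in> K3" by blast
  then have f2: "f \<in> K2" and f1: "f \<in> K1" and f: "f \<in> states N"
    by (auto simp: K1_def K2_def K3_def exposed_def)
  have same_value: "g x = f x" if g3: "g \<in> K3" for g
  proof -
    from g3 have g2: "g \<in> K2" and g1: "g \<in> K1" and g: "g \<in> states N"
      by (auto simp: K1_def K2_def K3_def exposed_def)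
    have "Re (g (- x)) = Re (f (- x))"
      using f2 g2 f1 g1 unfolding K2_def exposed_def by (simp add: order_antisym)
    moreover have "Re (g (\<i> *C x)) = Re (f (\<i> *C x))"
      using f3 g3 f2 g2 unfolding K3_def exposed_def by (simp add: order_antisym)
    ultimately show ?thesis by (simp add: state_simps[OF f] state_simps[OF g] complex_eq_iff)
  qed
  have mult: "f (h * x) = f h * f x" if "adj h = h" for h
  proof (rule multiplicative_if_indecomposable[OF comm f _ that])
    fix g h t
    assume "g \<in> states N" "h \<in> states N" "0 < (t::real)" "t < 1"
      "\<forall>y. f y = of_real t * g y + of_real (1 - t) * h y"
    then have "g \<in> K3" using K3(2) f3 unfolding state_face_def by blast
    then show "g x = f x" by (rule same_value)
  qed
  obtain h k where hk: "adj h = h" "adj k = k" "adj x = h - \<i> *C k"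
    by (rule hermitian_decomposition)
  have "f (adj x * x) = f (adj x) * f x"
    by (simp add: hk(3) left_diff_distrib scaleC_mult_left state_simps[OF f] mult[OF hk(1)] mult[OF hk(2)])
  then have fxx: "f (adj x * x) = of_real ((cmod (f x))\<^sup>2)"
    by (simp only: state_adj[OF f] complex_norm_square mult.commute)
  show ?thesis
  proof (rule that[OF f])
    fix g assume g: "g \<in> states N"
    show le: "Re (g (adj x * x)) \<le> (cmod (f x))\<^sup>2"
      using f1 g fxx by (simp add: K1_def exposed_def)
    assume "Re (g (adj x * x)) = (cmod (f x))\<^sup>2"
    then have "g \<in> K1" using f1 g fxx by (simp add: K1_def exposed_def)
    then have "Re (g (- x)) \<le> Re (f (- x))" using f2 by (simp add: K2_def exposed_def)
    then show "Re (f x) \<le> Re (g x)" by (simp add: state_simps[OF f] state_simps[OF g])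
  qed
qed

text \<open>The dominating state \<open>f\<close> has \<open>|f x| \<le> 1\<close>. If \<open>g (x\<^sup>* x) = 1\<close>, then \<open>|f x| = 1\<close>, so \<open>f\<close> is \<open>\<omega>\<close>
  and its minimality yields \<open>Re (g x) \<ge> Re (\<omega> x) = 1\<close>.\<close>

lemma peak_commutative:
  assumes comm: "\<And>x y :: 'a. x * y = y * x" and \<omega>: "\<omega> \<in> states N" "\<omega> x = 1"
    and peak: "\<And>f. f \<in> states N \<Longrightarrow> f \<noteq> \<omega> \<Longrightarrow> cmod (f x) < 1"
    and g: "g \<in> states N"
  shows "Re (g (adj x * x)) \<le> 1" "Re (g (adj x * x)) = 1 \<Longrightarrow> g = \<omega>"
proof -
  obtain f where f: "f \<in> states N"
    and f_max: "\<And>g. g \<in> states N \<Longrightarrow> Re (g (adj x * x)) \<le> (cmod (f x))\<^sup>2"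
    and f_min: "\<And>g. g \<in> states N \<Longrightarrow> Re (g (adj x * x)) = (cmod (f x))\<^sup>2 \<Longrightarrow> Re (f x) \<le> Re (g x)"
    using dominating_state[OF comm, of x] \<omega>(1) by blast
  have fx: "cmod (f x) \<le> 1" using peak[OF f] \<omega>(2) by (cases "f = \<omega>") auto
  then have sq: "(cmod (f x))\<^sup>2 \<le> 1" by (simp add: power_le_one)
  show "Re (g (adj x * x)) \<le> 1" using f_max[OF g] sq by linarith
  assume one: "Re (g (adj x * x)) = 1"
  then have fx1: "(cmod (f x))\<^sup>2 = 1" using f_max[OF g] sq by linarith
  then have "cmod (f x) = 1" by (simp add: power2_eq_1_iff) (smt (verit) norm_ge_zero)
  then have "f = \<omega>" using peak[OF f] by auto
  then have "1 \<le> Re (g x)" using f_min[OF g] one fx1 \<omega>(2) by simp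
  then have "\<not> cmod (g x) < 1" using complex_Re_le_cmod[of "g x"] by linarith
  then show "g = \<omega>" using peak[OF g] by blast
qed

end

text \<open>For the hermitian matrix \<open>h\<close> with corners \<open>y\<close> and \<open>y\<^sup>*\<close>, commutativity makes \<open>h\<^sup>2\<close> the diagonal matrix of
  \<open>y\<^sup>* y\<close>, and the Schwarz inequality bounds \<open>\<Psi> h = 2 Re (\<Psi> (corner y))\<close>. Rotating \<open>z\<close> by a scalar replaces the
  real part by the modulus.\<close>

lemma corner_bound:
  fixes N :: "'a::complex_star_algebra mat2 \<Rightarrow> real"
  assumes comm: "\<And>x y :: 'a. x * y = y * x" and "cstar_norm N" and \<Psi>: "\<Psi> \<in> states N"
  shows "(2 * cmod (\<Psi> (corner z)))\<^sup>2 \<le> Re (\<Psi> (diag2 (adj z * z)))"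
proof -
  interpret cstar_normed N by unfold_locales (rule assms)
  have re: "(2 * Re (\<Psi> (corner y)))\<^sup>2 \<le> Re (\<Psi> (diag2 (adj y * y)))" for y
  proof -
    let ?h = "corner y + adj (corner y)"
    have "?h * ?h = diag2 (adj y * y)"
      by (simp add: corner_def diag2_def mat2_defs star_simps comm[of y])
    moreover have "Re (\<Psi> ?h) = 2 * Re (\<Psi> (corner y))"
      by (simp add: state_simps[OF \<Psi>] state_adj[OF \<Psi>])
    moreover have "adj ?h = ?h" by (simp add: star_simps add.commute)
    ultimately show ?thesis using state_schwarz[OF \<Psi>, of ?h] by simp
  qed
  let ?w = "\<Psi> (corner z)"
  define u where "u = (if ?w = 0 then 1 else cnj ?w / cmod ?w)"
  have u: "cmod u = 1" by (simp add: u_def norm_divide)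
  have "u * ?w = cmod ?w"
    by (simp add: u_def mult.commute[of "cnj _"] complex_norm_square[symmetric] power2_eq_square)
  moreover have "corner (u *C z) = u *C corner z" by (simp add: corner_def mat2_defs star_simps)
  ultimately have "Re (\<Psi> (corner (u *C z))) = cmod ?w" by (simp add: state_simps(2)[OF \<Psi>])
  moreover have "adj (u *C z) * (u *C z) = adj z * z"
  proof -
    have "cnj u * u = 1" using u by (simp add: complex_norm_square[symmetric] mult.commute)
    then show ?thesis by (simp add: star_simps mult.commute)
  qed
  ultimately show ?thesis using re[of "u *C z"] by simp
qed

text \<open>The diagonal \<open>1/2\<close> fixes the phase: \<open>|1/2 + w| \<ge> 1\<close> with \<open>|w| \<le> 1/2\<close> forces \<open>w = 1/2\<close>. So a state \<open>\<Psi>\<close> that is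
  not smaller than \<open>1\<close> in modulus at the peaking matrix attains the corner bound at \<open>x\<close>, and its
  diagonal state is \<open>\<omega>\<close>. The corner bound at \<open>1 - x\<close> then transfers the value \<open>1/2\<close> from the corner \<open>x\<close> to the
  corner \<open>1\<close>, which identifies \<open>\<Psi>\<close> as \<open>Phi \<omega>\<close>.\<close>

lemma peak_Phi_of_peak_state:
  fixes K :: "'a::complex_star_algebra \<Rightarrow> real"
  assumes comm: "\<And>x y :: 'a. x * y = y * x" and "cstar_norm K" "cstar_norm N"
    and peak: "peak_state K M \<omega>"
  shows "peak_state N (triangular_algebra M) (Phi \<omega>)"
proof -
  interpret K: cstar_normed K by unfold_locales (rule assms)
  interpret N: cstar_normed N by unfold_locales (rule assms)
  obtain x where \<omega>: "\<omega> \<in> states K" and x: "x \<in> M" "\<omega> x = 1"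
    and lt: "\<And>f. f \<in> states K \<Longrightarrow> f \<noteq> \<omega> \<Longrightarrow> cmod (f x) < 1"
    using peak unfolding peak_state_def by blast
  note Phi_\<omega> = Phi_state[OF assms(2,3) \<omega>]
  let ?a = "(1/2) *C 1 + corner x"
  have "?a \<in> triangular_algebra M"
    unfolding triangular_eq[symmetric] triangular_algebra_def using x(1) by blast
  moreover have "Phi \<omega> ?a = 1"
    by (simp add: state_simps[OF Phi_\<omega>] Phi_corner[OF \<omega>] x)
  moreover have "cmod (\<Psi> ?a) < 1" if \<Psi>: "\<Psi> \<in> states N" and ne: "\<Psi> \<noteq> Phi \<omega>" for \<Psi>
  proof (rule ccontr)
    assume ge: "\<not> cmod (\<Psi> ?a) < 1"
    define w where "w = \<Psi> (corner x)"
    let ?\<rho> = "\<lambda>b. \<Psi> (diag2 b)"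
    have \<rho>: "?\<rho> \<in> states K" by (rule state_diag2[OF assms(2,3) \<Psi>])
    have \<rho>_le: "Re (?\<rho> (adj x * x)) \<le> 1"
      by (rule K.peak_commutative(1)[where \<omega> = \<omega>]) (fact comm \<omega> x(2) \<rho> | erule (1) lt)+
    have bound: "(2 * cmod w)\<^sup>2 \<le> Re (?\<rho> (adj x * x))"
      unfolding w_def by (rule corner_bound[OF comm assms(3) \<Psi>])
    then have "(2 * cmod w)\<^sup>2 \<le> 1\<^sup>2" using \<rho>_le by simp
    then have w_le: "cmod w \<le> 1/2" using power2_le_imp_le[of "2 * cmod w" 1] by simp
    have "\<Psi> ?a = 1/2 + w" by (simp add: state_simps[OF \<Psi>] w_def)
    with ge have "1 \<le> cmod (1/2 + w)" by simp
    then have "1 \<le> (cmod (1/2 + w))\<^sup>2" by (simp add: one_le_power)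
    also have "\<dots> = 1/4 + Re w + (cmod w)\<^sup>2"
      unfolding cmod_power2 by (simp add: power2_eq_square algebra_simps)
    also have "\<dots> \<le> 1/4 + Re w + (1/2)\<^sup>2" using w_le by (intro add_mono power_mono) auto
    finally have "1/2 \<le> Re w" by (simp add: power2_eq_square)
    then have Re_w: "Re w = 1/2" and cmod_w: "cmod w = 1/2"
      using w_le complex_Re_le_cmod[of w] by linarith+
    have sq: "Re (?\<rho> (adj x * x)) = 1" using bound \<rho>_le by (simp add: cmod_w)
    have \<rho>_eq: "?\<rho> = \<omega>"
      by (rule K.peak_commutative(2)[where x = x]) (fact comm \<omega> x(2) \<rho> sq | erule (1) lt)+
    have \<rho>x: "\<Psi> (diag2 x) = 1" using fun_cong[OF \<rho>_eq, of x] x(2) by simp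
    have "adj (1 - x) * (1 - x) = 1 - x - adj x + adj x * x"
      by (simp add: star_simps algebra_simps)
    then have "Re (?\<rho> (adj (1 - x) * (1 - x))) = 0"
      using sq by (simp add: state_simps[OF \<rho>] K.state_adj[OF \<rho>] \<rho>x)
    then have "\<Psi> (corner (1 - x)) = 0"
      using corner_bound[OF comm assms(3) \<Psi>, of "1 - x"] by simp
    moreover have "corner (1 - x) = corner 1 - corner x" by (simp add: corner_def mat2_defs)
    ultimately have "\<Psi> (corner 1) = w" by (simp add: state_simps[OF \<Psi>] w_def)
    then have "\<Psi> = Phi ?\<rho>" by (intro state_eq_Phi[OF assms(3) \<Psi>]) (simp add: Re_w)
    then show False using ne \<rho>_eq by simp
  qed
  ultimately show ?thesis using Phi_\<omega> unfolding peak_state_def by blast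
qed

theorem theorem6p2:
  fixes M :: "'b::cstar_algebra set"
    and \<omega> :: "'b \<Rightarrow> complex"
    and N :: "'b mat2 \<Rightarrow> real"
  assumes "unital_subspace M"
    and "\<omega> \<in> states norm"
    and "cstar_norm N"
  shows "(has_unique_state_extension norm M \<omega> \<longleftrightarrow>
            has_unique_state_extension N (triangular_algebra M) (Phi \<omega>)) \<and>
         (peak_state N (triangular_algebra M) (Phi \<omega>) \<longrightarrow> peak_state norm M \<omega>) \<and>
         ((\<forall>x y :: 'b. x * y = y * x) \<longrightarrow>
            (peak_state norm M \<omega> \<longleftrightarrow> peak_state N (triangular_algebra M) (Phi \<omega>)))"
  using unique_extension_iff[OF assms(1) cstar_norm_norm assms(3,2)]
    peak_state_of_peak_Phi[OF assms(1) cstar_norm_norm assms(3,2)]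
    peak_Phi_of_peak_state[OF _ cstar_norm_norm assms(3)]
  by blast

end
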